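(* For $d>2$, we have $$r(d,n)\geq \frac{1}{2}(n+1)^{2/2^d}.$$
   Context: Let $n$ and $d$ be positive integers, let $[n]=\{1,2,\ldots,n\}$, and let $2^{[n]}$ denote the power set of $[n]$. A collection $\mathcal{B}\subseteq 2^{[n]}$ forms a $d$-dimensional Boolean algebra (a copy of $\mathcal{B}_d$) if there exist pairwise disjoint sets $X_0,X_1,\ldots,X_d\subseteq[n]$, all non-empty with perhaps the exception of $X_0$, such that $\mathcal{B}=\{X_0\cup\bigcup_{i\in I}X_i : I\subseteq[d]\}$, where $[d]=\{1,\ldots,d\}$. An $r$-coloring of $2^{[n]}$ assigns to each subset of $[n]$ one of $r$ colors, and a copy of $\mathcal{B}_d$ is monochromatic if all of its members have the same color. Define $r(d,n)$ to be the largest integer $r$ such that every $r$-coloring of $2^{[n]}$ contains a monochromatic copy of $\mathcal{B}_d$.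
   Formalization: The bound as printed fails for n < d and for d = 3, n = 16; proved instead: for each fixed d > 2 it holds for all sufficiently large n, and for every n > 0 it holds with the right-hand side rounded down to an integer. *)

theory Defs
  imports Complex_Main "HOL-Library.FuncSet" "HOL-Library.Disjoint_Sets"
begin

definition boolean_algebra_copy :: "nat \<Rightarrow> nat \<Rightarrow> nat set set \<Rightarrow> bool" where
  "boolean_algebra_copy d n \<B> \<longleftrightarrow>
     (\<exists>X :: nat \<Rightarrow> nat set.
        (\<forall>i\<in>{0..d}. X i \<subseteq> {1..n}) \<and>
        disjoint_family_on X {0..d} \<and>
        (\<forall>i\<in>{1..d}. X i \<noteq> {}) \<and>
        \<B> = {X 0 \<union> (\<Union>i\<in>I. X i) | I. I \<subseteq> {1..d}})"

text \<open>A colouring need not use all of its colours.\<close>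

definition colouring :: "nat \<Rightarrow> nat \<Rightarrow> (nat set \<Rightarrow> nat) \<Rightarrow> bool" where
  "colouring r n c \<longleftrightarrow> c \<in> Pow {1..n} \<rightarrow> {1..r}"

definition monochromatic :: "(nat set \<Rightarrow> nat) \<Rightarrow> nat set set \<Rightarrow> bool" where
  "monochromatic c \<B> \<longleftrightarrow> (\<exists>k. \<forall>A\<in>\<B>. c A = k)"

definition forces_copy :: "nat \<Rightarrow> nat \<Rightarrow> nat \<Rightarrow> bool" where
  "forces_copy d n r \<longleftrightarrow>
     (\<forall>c. colouring r n c \<longrightarrow> (\<exists>\<B>. boolean_algebra_copy d n \<B> \<and> monochromatic c \<B>))"

text \<open>The maximum exists for \<open>d > 0\<close>, see \<open>boolean_ramsey_forces\<close> and \<open>boolean_ramsey_greatest\<close> below.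
  It is \<open>0\<close> if \<open>n < d\<close>, when there are no copies at all: \<open>r = 0\<close> is always admissible,
  because there is no colouring with \<open>0\<close> colours.\<close>

definition boolean_ramsey :: "nat \<Rightarrow> nat \<Rightarrow> nat" where
  "boolean_ramsey d n = (GREATEST r. forces_copy d n r)"

lemma boolean_algebra_copyE:
  assumes "boolean_algebra_copy d n \<B>"
  obtains X where "\<And>i. i \<le> d \<Longrightarrow> X i \<subseteq> {1..n}"
    "\<And>i. i \<in> {1..d} \<Longrightarrow> X i \<noteq> {}" "\<And>I. I \<subseteq> {1..d} \<Longrightarrow> X 0 \<union> (\<Union>i\<in>I. X i) \<in> \<B>"
    "\<And>I. I \<subseteq> {1..d} \<Longrightarrow> card (X 0 \<union> (\<Union>i\<in>I. X i)) = card (X 0) + (\<Sum>i\<in>I. card (X i))"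
proof -
  from assms obtain X where X: "\<forall>i\<in>{0..d}. X i \<subseteq> {1..n}" "disjoint_family_on X {0..d}"
    "\<forall>i\<in>{1..d}. X i \<noteq> {}" "\<B> = {X 0 \<union> (\<Union>i\<in>I. X i) | I. I \<subseteq> {1..d}}"
    unfolding boolean_algebra_copy_def by blast
  have "card (X 0 \<union> (\<Union>i\<in>I. X i)) = card (X 0) + (\<Sum>i\<in>I. card (X i))" if "I \<subseteq> {1..d}" for I
  proof -
    have sub: "insert 0 I \<subseteq> {0..d}" "0 \<notin> I" "finite I"
      using that finite_subset by auto
    have "finite (X i)" if "i \<in> insert 0 I" for i
      using that sub X(1) by (meson finite_atLeastAtMost finite_subset subsetD)
    moreover have "X i \<inter> X j = {}" if "i \<in> insert 0 I" "j \<in> insert 0 I" "i \<noteq> j" for i j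
      using that sub X(2) unfolding disjoint_family_on_def by blast
    ultimately have "card (\<Union>i\<in>insert 0 I. X i) = (\<Sum>i\<in>insert 0 I. card (X i))"
      using sub by (intro card_UN_disjoint) auto
    thus ?thesis using sub by simp
  qed
  with X show thesis by (intro that[of X]) auto
qed

lemma forces_copy_0: "forces_copy d n 0"
  by (auto simp: forces_copy_def colouring_def Pi_def)

lemma forces_copy_antimono:
  assumes "forces_copy d n r" "s \<le> r"
  shows "forces_copy d n s"
proof -
  have "colouring r n c" if "colouring s n c" for c
    using that assms(2) Pi_mono[of "Pow {1..n}" "\<lambda>_. {1..s}" "\<lambda>_. {1..r}"]
    unfolding colouring_def by auto
  thus ?thesis using assms(1) unfolding forces_copy_def by blast
qed

lemma forces_copy_le:
  assumes "forces_copy d n r" "d > 0"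
  shows "r \<le> n"
proof (rule ccontr)
  assume "\<not> r \<le> n"
  have card_le: "card A \<le> n" if "A \<subseteq> {1..n}" for A :: "nat set"
    using card_mono[OF _ that] by simp
  have "Suc (card A) \<in> {1..r}" if "A \<in> Pow {1..n}" for A
    using card_le[of A] that \<open>\<not> r \<le> n\<close> by simp
  hence "colouring r n (\<lambda>A. Suc (card A))"
    unfolding colouring_def by (rule Pi_I)
  then obtain \<B> k where \<B>: "boolean_algebra_copy d n \<B>" "\<forall>A\<in>\<B>. Suc (card A) = k"
    using assms(1) unfolding forces_copy_def monochromatic_def by blast
  from \<B>(1) obtain X :: "nat \<Rightarrow> nat set" where X: "\<And>i. i \<le> d \<Longrightarrow> X i \<subseteq> {1..n}" "\<And>i. i \<in> {1..d} \<Longrightarrow> X i \<noteq> {}"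
    "\<And>I. I \<subseteq> {1..d} \<Longrightarrow> X 0 \<union> (\<Union>i\<in>I. X i) \<in> \<B>"
    "\<And>I. I \<subseteq> {1..d} \<Longrightarrow> card (X 0 \<union> (\<Union>i\<in>I. X i)) = card (X 0) + (\<Sum>i\<in>I. card (X i))"
    by (rule boolean_algebra_copyE) (rule that)
  have "X 0 \<in> \<B>" "X 0 \<union> X 1 \<in> \<B>"
    using X(3)[of "{}"] X(3)[of "{1}"] \<open>d > 0\<close> by simp_all
  hence "Suc (card (X 0)) = Suc (card (X 0 \<union> X 1))"
    using \<B>(2) by metis
  hence "card (X 0) = card (X 0) + card (X 1)"
    using X(4)[of "{1}"] \<open>d > 0\<close> by simp
  moreover have "finite (X 1)" "X 1 \<noteq> {}"
    using X(1)[of 1] X(2)[of 1] \<open>d > 0\<close> finite_subset[OF _ finite_atLeastAtMost] by simp_all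
  ultimately show False by simp
qed

lemma boolean_ramsey_forces:
  assumes "d > 0"
  shows "forces_copy d n (boolean_ramsey d n)"
  unfolding boolean_ramsey_def
  by (rule GreatestI_nat[of _ 0 n]) (simp_all add: forces_copy_0 forces_copy_le assms)

lemma boolean_ramsey_greatest:
  assumes "d > 0" "forces_copy d n r"
  shows "r \<le> boolean_ramsey d n"
  unfolding boolean_ramsey_def
  by (rule Greatest_le_nat[of _ r n]) (simp_all add: forces_copy_le assms)

text \<open>The inequality \<open>1/2 * (n + 1) powr (2 / 2 ^ d) \<le> boolean_ramsey d n\<close> fails not only for
  \<open>n < d\<close>. For \<open>d = 3\<close> and \<open>n = 16\<close> its left-hand side exceeds \<open>1\<close>, but there is a 2-colouring by size
  without a monochromatic copy: the list \<open>T\<close> below gives the colour of each size, and \<open>cube_free d T\<close>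
  says that no \<open>a\<close> and \<open>x\<^sub>1, \<dots>, x\<^sub>d > 0\<close> have all \<open>a + (\<Sum>i\<in>I. x\<^sub>i)\<close> at entries \<open>True\<close> of \<open>T\<close>.\<close>

fun cube_free :: "nat \<Rightarrow> bool list \<Rightarrow> bool" where
  "cube_free 0 T = (True \<notin> set T)"
| "cube_free (Suc d) T = (\<forall>x\<in>set [1..<length T]. cube_free d (map2 (\<and>) T (drop x T)))"

lemma cube_freeD:
  assumes "cube_free (Suc (Suc (Suc 0))) T" "x > 0" "y > 0" "z > 0" "a + x + y + z < length T"
  shows "\<exists>t\<in>{0, x, y, z, x + y, x + z, y + z, x + y + z}. \<not> T ! (a + t)"
proof -
  define U where "U = map2 (\<and>) T (drop x T)"
  define V where "V = map2 (\<and>) U (drop y U)"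
  define W where "W = map2 (\<and>) V (drop z V)"
  have "cube_free (Suc (Suc 0)) U"
    using assms by (auto simp: U_def simp del: cube_free.simps(1))
  hence "cube_free (Suc 0) V"
    using assms by (auto simp: U_def V_def simp del: cube_free.simps(1))
  hence "cube_free 0 W"
    using assms by (auto simp: U_def V_def W_def simp del: cube_free.simps(1))
  moreover have len: "length W = length T - x - y - z" by (simp add: U_def V_def W_def)
  moreover have "a < length W" using len assms(5) by simp
  ultimately have "\<not> W ! a" using nth_mem[of a W] by (cases "W ! a") auto
  thus ?thesis using assms(5) by (auto simp: U_def V_def W_def ac_simps)
qed

lemma boolean_ramsey_3_16: "real (boolean_ramsey 3 16) < 1/2 * (real 16 + 1) powr (2 / 2 ^ 3)"
proof -
  define T where "T = [False, True, False, True, True, False, True, False, False,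
                       False, True, True, True, False, True, False, False]"
  define c :: "nat set \<Rightarrow> nat" where "c = (\<lambda>A. if T ! card A then 1 else 2)"
  have cf: "cube_free (Suc (Suc (Suc 0))) T" "cube_free (Suc (Suc (Suc 0))) (map Not T)"
    unfolding T_def by code_simp+
  have len: "length T = 17" by (simp add: T_def)
  have check: "\<exists>t\<in>{x, y, z, x + y, x + z, y + z, x + y + z}. T ! (a + t) \<noteq> T ! a"
    if "x > 0" "y > 0" "z > 0" "a + x + y + z \<le> 16" for a x y z
    using cube_freeD[OF cf(1) that(1-3), of a] cube_freeD[OF cf(2) that(1-3), of a] that(4)
    by (cases "T ! a") (auto simp: len ac_simps)
  have "\<not> forces_copy 3 16 2"
  proof
    assume f: "forces_copy 3 16 2"
    have "colouring 2 16 c" by (auto simp: colouring_def c_def)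
    with f obtain \<B> k where \<B>: "boolean_algebra_copy 3 16 \<B>" "\<forall>A\<in>\<B>. c A = k"
      unfolding forces_copy_def monochromatic_def by blast
    from \<B>(1) obtain X :: "nat \<Rightarrow> nat set" where X: "\<And>i. i \<le> 3 \<Longrightarrow> X i \<subseteq> {1..16}" "\<And>i. i \<in> {1..3} \<Longrightarrow> X i \<noteq> {}"
      "\<And>I. I \<subseteq> {1..3} \<Longrightarrow> X 0 \<union> (\<Union>i\<in>I. X i) \<in> \<B>"
      "\<And>I. I \<subseteq> {1..3} \<Longrightarrow> card (X 0 \<union> (\<Union>i\<in>I. X i)) = card (X 0) + (\<Sum>i\<in>I. card (X i))"
      by (rule boolean_algebra_copyE) (rule that)
    define m where "m = (\<lambda>i. card (X i))"
    have same: "T ! (m 0 + (\<Sum>i\<in>I. m i)) = T ! m 0" if "I \<subseteq> {1..3}" for I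
    proof -
      have "c (X 0 \<union> (\<Union>i\<in>I. X i)) = c (X 0)"
        using \<B>(2) X(3)[OF that] X(3)[of "{}"] by simp
      thus ?thesis using X(4)[OF that] by (auto simp: c_def m_def split: if_splits)
    qed
    have "finite (X i)" if "i \<in> {1..3}" for i
      using that X(1)[of i] finite_subset by auto
    hence pos: "m i > 0" if "i \<in> {1..3}" for i
      using that X(2)[of i] unfolding m_def by (metis card_gt_0_iff)
    have "m 0 + (\<Sum>i\<in>{1..3}. m i) = card (X 0 \<union> (\<Union>i\<in>{1..3}. X i))"
      using X(4)[of "{1..3}"] by (simp add: m_def)
    also have "\<dots> \<le> card {1..16::nat}"
    proof (rule card_mono)
      have "X i \<subseteq> {1..16}" if "i \<in> {0..3}" for i using X(1) that by simp
      thus "X 0 \<union> (\<Union>i\<in>{1..3}. X i) \<subseteq> {1..16}" by force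
    qed simp
    finally have le: "m 0 + m 1 + m 2 + m 3 \<le> 16" by (simp add: numeral_eq_Suc)
    show False
      using check[OF pos[of 1] pos[of 2] pos[of 3] le] same[of "{1}"] same[of "{2}"] same[of "{3}"]
        same[of "{1,2}"] same[of "{1,3}"] same[of "{2,3}"] same[of "{1,2,3}"]
      by (auto simp: add.assoc)
  qed
  hence "\<not> 2 \<le> boolean_ramsey 3 16"
    using forces_copy_antimono[OF boolean_ramsey_forces[of 3 16], of 2] by linarith
  hence "boolean_ramsey 3 16 \<le> 1" by simp
  moreover have "(2::real) < 17 powr (1/4)"
  proof -
    have "(2::real) = (2 powr 4) powr (1/4)" by (subst powr_powr) simp
    also have "\<dots> < 17 powr (1/4)" by (intro powr_less_mono2) auto
    finally show ?thesis .
  qed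
  ultimately show ?thesis by simp
qed

end

theory Submission
  imports Defs "HOL-Analysis.Convex"
begin

text \<open>
  Pick a maximal chain of subsets of an \<open>n\<close>-element set \<open>S\<close> uniformly at random. It passes through a
  given set \<open>A\<close> with probability \<open>1 / (n choose card A)\<close>, so the Lubell value \<open>h\<close> of a family \<open>F\<close>, the
  sum of these probabilities over \<open>A \<in> F\<close>, is the expected number of members of \<open>F\<close> on the chain. The
  Lubell value of all of \<open>Pow S\<close> is \<open>n + 1\<close>, so among \<open>r\<close> colour classes one has Lubell value at least
  \<open>(n + 1) / r\<close>. What remains is a Turan type bound (\<open>lubell_cube_free_less\<close>): for \<open>d \<ge> 2\<close> a family
  without a \<open>d\<close>-dimensional Boolean algebra has \<open>h < 8/5 * (n + 1) powr (1 - 2 / 2 ^ d)\<close>.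

  The bound is proved by induction on \<open>d\<close>, as in Hilbert's cube lemma. By convexity the expected number
  of pairs of members on the chain is at least \<open>h * (h - 1) / 2\<close> (\<open>lubell_squared_le\<close>). A pair
  \<open>A \<subset> B\<close> lies on the chain with probability
  \<open>1 / ((n choose card B) * (card B choose card A))\<close>, and with \<open>D = B - A\<close> this equals
  \<open>1 / ((n choose card D) * (card (S - D) choose card A))\<close>. Hence the expected number of pairs is also
  the sum over non-empty \<open>D\<close> of \<open>1 / (n choose card D)\<close> times the Lubell value, inside \<open>S - D\<close>, of the
  family \<open>F\<^sub>D\<close> of all \<open>A \<in> F\<close> disjoint from \<open>D\<close> with \<open>A \<union> D \<in> F\<close> (\<open>lubell_pairs_by_difference\<close>).
  If \<open>F\<close> has no \<open>(d + 1)\<close>-dimensional algebra, then no \<open>F\<^sub>D\<close> has a \<open>d\<close>-dimensional one, and the bound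
  \<open>\<phi> m\<close> for dimension \<open>d\<close> and \<open>m\<close> points yields \<open>h\<^sup>2 - h \<le> 2 * (\<Sum>m<n. \<phi> m)\<close>
  (\<open>lubell_cube_free_step\<close>). As \<open>m ^ \<beta>\<close> sums to about \<open>n ^ (\<beta> + 1) / (\<beta> + 1)\<close>, each step replaces the
  exponent \<open>\<beta>\<close> by \<open>(\<beta> + 1) / 2\<close>, which leads from \<open>0\<close> at \<open>d = 1\<close> to \<open>1 - 2 / 2 ^ d\<close>.

  Any constant below \<open>2\<close> in place of \<open>8/5\<close> would beat the factor \<open>1/2\<close> of the claim. With \<open>8/5\<close> every
  number of colours up to \<open>5/8 * (n + 1) powr (2 / 2 ^ d)\<close> forces a monochromatic algebra. The gap
  between \<open>1/2\<close> and \<open>5/8\<close> is what allows rounding up to an integer number of colours once \<open>n\<close> is large;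
  rounding down needs no gap.
\<close>

section \<open>The Lubell functional\<close>

text \<open>The expectation of the sum of \<open>g\<close> over the members of a random maximal chain in \<open>Pow S\<close>.
  Arbitrary functions, rather than families only, are needed because the number of pairs on the chain is
  the functional applied to a function that is itself a Lubell value.\<close>

definition lubell :: "'a set \<Rightarrow> ('a set \<Rightarrow> real) \<Rightarrow> real" where
  "lubell S g = (\<Sum>A\<in>Pow S. g A / real (card S choose card A))"

abbreviation lubell_family :: "'a set \<Rightarrow> 'a set set \<Rightarrow> real" where
  "lubell_family S F \<equiv> lubell S (\<lambda>A. of_bool (A \<in> F))"

lemma lubell_mono:
  assumes "\<And>A. A \<subseteq> S \<Longrightarrow> g A \<le> h A"
  shows "lubell S g \<le> lubell S h"
  unfolding lubell_def by (intro sum_mono divide_right_mono assms) auto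

lemma lubell_cong:
  assumes "\<And>A. A \<subseteq> S \<Longrightarrow> g A = h A"
  shows "lubell S g = lubell S h"
  unfolding lubell_def by (intro sum.cong) (auto simp: assms)

lemma lubell_diff: "lubell S (\<lambda>A. g A - h A) = lubell S g - lubell S h"
  by (simp add: lubell_def diff_divide_distrib sum_subtractf)

lemma lubell_cmult: "lubell S (\<lambda>A. c * g A) = c * lubell S g"
  by (simp add: lubell_def sum_distrib_left)

lemma lubell_sum: "lubell S (\<lambda>A. \<Sum>i\<in>I. g i A) = (\<Sum>i\<in>I. lubell S (g i))"
  unfolding lubell_def by (simp add: sum_divide_distrib, rule sum.swap)

lemma lubell_empty: "lubell {} g = g {}"
  by (simp add: lubell_def)

text \<open>A maximal chain has exactly one member of each size.\<close>

lemma lubell_card: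
  assumes "finite S"
  shows "lubell S (\<lambda>A. \<phi> (card A)) = (\<Sum>k\<le>card S. \<phi> k)"
proof -
  have "lubell S (\<lambda>A. \<phi> (card A)) =
      (\<Sum>k\<le>card S. \<Sum>A\<in>{A \<in> Pow S. card A = k}. \<phi> (card A) / real (card S choose card A))"
    unfolding lubell_def using assms
    by (intro sum.group[symmetric]) (auto intro: card_mono)
  also have "\<dots> = (\<Sum>k\<le>card S. \<phi> k)"
  proof (intro sum.cong refl)
    fix k assume "k \<in> {..card S}"
    have "(\<Sum>A\<in>{A \<in> Pow S. card A = k}. \<phi> (card A) / real (card S choose card A))
        = real (card {A. A \<subseteq> S \<and> card A = k}) * (\<phi> k / real (card S choose k))"
      by simp
    also have "\<dots> = \<phi> k"
      using \<open>k \<in> _\<close> n_subsets[OF assms, of k] by simp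
    finally show "(\<Sum>A\<in>{A \<in> Pow S. card A = k}. \<phi> (card A) / real (card S choose card A)) = \<phi> k" .
  qed
  finally show ?thesis .
qed

text \<open>A random maximal chain in \<open>Pow S\<close> starts with \<open>S\<close> and continues as a random maximal chain in
  \<open>Pow (S - {x})\<close>, where \<open>x \<in> S\<close> is random. Inductions along this recursion replace any counting
  of chains.\<close>

lemma lubell_remove1:
  assumes "finite S" "S \<noteq> {}"
  shows "lubell S g = g S + (\<Sum>x\<in>S. lubell (S - {x}) g) / card S"
proof -
  define n where "n = card S"
  have n: "n > 0" using assms by (simp add: n_def card_gt_0_iff)
  have "(\<Sum>x\<in>S. lubell (S - {x}) g)
      = (\<Sum>x\<in>S. \<Sum>A\<in>Pow S - {S}. if x \<in> A then 0 else g A / real (n - 1 choose card A))"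
  proof (intro sum.cong refl)
    fix x assume x: "x \<in> S"
    have "lubell (S - {x}) g = (\<Sum>A\<in>Pow (S - {x}). g A / real (n - 1 choose card A))"
      using assms x by (simp add: lubell_def n_def)
    also have "\<dots> = (\<Sum>A\<in>Pow S - {S}. if x \<in> A then 0 else g A / real (n - 1 choose card A))"
      using assms x by (intro sum.mono_neutral_cong_left) auto
    finally show "lubell (S - {x}) g = \<dots>" .
  qed
  also have "\<dots> = (\<Sum>A\<in>Pow S - {S}. \<Sum>x\<in>S. if x \<in> A then 0 else g A / real (n - 1 choose card A))"
    by (rule sum.swap)
  also have "\<dots> = (\<Sum>A\<in>Pow S - {S}. n * (g A / real (n choose card A)))"
  proof (intro sum.cong refl)
    fix A assume A: "A \<in> Pow S - {S}"
    hence le: "card A < n" unfolding n_def using assms by (intro psubset_card_mono) auto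
    have fA: "finite A" using A assms finite_subset by auto
    have "(\<Sum>x\<in>S. if x \<in> A then 0 else g A / real (n - 1 choose card A))
        = (\<Sum>x\<in>S - A. g A / real (n - 1 choose card A))"
      using assms by (intro sum.mono_neutral_cong_right) auto
    also have "\<dots> = real (n - card A) * (g A / real (n - 1 choose card A))"
      using A fA by (simp add: card_Diff_subset n_def)
    also have "\<dots> = n * (g A / real (n choose card A))"
    proof -
      define b c where "b = real (n - 1 choose card A)" and "c = real (n choose card A)"
      have "real (n - card A) * c = n * b"
        unfolding b_def c_def by (metis binomial_absorb_comp of_nat_mult)
      moreover have "b > 0" "c > 0" using le by (auto simp: b_def c_def)
      ultimately have "real (n - card A) / b = n / c" by (simp add: field_simps)
      hence "g A * (real (n - card A) / b) = g A * (n / c)" by simp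
      thus ?thesis by (simp add: b_def c_def mult.commute)
    qed
    finally show "(\<Sum>x\<in>S. if x \<in> A then 0 else g A / real (n - 1 choose card A))
      = n * (g A / real (n choose card A))" .
  qed
  also have "\<dots> = n * (lubell S g - g S)"
    using assms by (simp add: lubell_def n_def sum_distrib_left sum.remove[of "Pow S" S])
  finally show ?thesis using n by (simp add: n_def)
qed

section \<open>Pairs of comparable sets\<close>

text \<open>This is the inequality between the square of the mean and the mean of the square of
  \<open>X = (\<Sum>A. f A)\<close>, the sum running over a random chain: in \<open>X\<^sup>2\<close>, collect the products \<open>f A * f B\<close> by the
  larger set \<open>B\<close>. Given that the chain passes through \<open>B\<close>, its part up to \<open>B\<close> is a random chain in
  \<open>Pow B\<close>, which makes \<open>lubell B f - f B\<close> the expected contribution of the sets strictly below \<open>B\<close>;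
  it counts twice, the diagonal term \<open>f B * f B\<close> once.\<close>

lemma lubell_squared_le:
  assumes "finite S"
  shows "(lubell S f)\<^sup>2 \<le> lubell S (\<lambda>B. f B * (2 * lubell B f - f B))"
  using assms
proof (induction "card S" arbitrary: S)
  case 0
  then show ?case by (simp add: lubell_empty power2_eq_square)
next
  case (Suc m)
  define n where "n = card S"
  have n: "n > 0" and S: "S \<noteq> {}" using Suc.hyps(2) by (auto simp: n_def)
  define q where "q = (\<lambda>B. f B * (2 * lubell B f - f B))"
  define G where "G = (\<Sum>x\<in>S. lubell (S - {x}) f) / n"
  have L: "lubell S f = f S + G"
    using lubell_remove1[OF Suc.prems S] by (simp add: G_def n_def)
  have "n * (n * G\<^sup>2) = (\<Sum>x\<in>S. lubell (S - {x}) f)\<^sup>2"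
    using n by (simp add: G_def power2_eq_square)
  also have "\<dots> \<le> n * (\<Sum>x\<in>S. (lubell (S - {x}) f)\<^sup>2)"
    unfolding n_def by (subst mult.commute) (rule sum_squared_le_sum_of_squares)
  finally have "n * G\<^sup>2 \<le> (\<Sum>x\<in>S. (lubell (S - {x}) f)\<^sup>2)"
    using n by simp
  also have "\<dots> \<le> (\<Sum>x\<in>S. lubell (S - {x}) q)"
    unfolding q_def using Suc.hyps(2) Suc.prems by (intro sum_mono Suc.hyps(1)) auto
  finally have "G\<^sup>2 \<le> (\<Sum>x\<in>S. lubell (S - {x}) q) / n"
    using n by (simp add: field_simps)
  hence "q S + G\<^sup>2 \<le> lubell S q"
    using lubell_remove1[OF Suc.prems S, of q] by (simp add: n_def)
  moreover have "(lubell S f)\<^sup>2 = q S + G\<^sup>2"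
    by (simp add: q_def L power2_eq_square algebra_simps)
  ultimately show ?case by (simp add: q_def)
qed

text \<open>Both sides are the expected sum of \<open>g A B\<close> over pairs \<open>A \<subseteq> B\<close> on a random chain. The multinomial
  coefficient of the partition of \<open>S\<close> into \<open>A\<close>, \<open>D = B - A\<close> and \<open>S - B\<close> is the inverse of the weight of
  the pair. It factors by choosing \<open>B\<close> and then \<open>A\<close> inside, or \<open>D\<close> and then \<open>A\<close> outside.\<close>

lemma lubell_pairs_by_difference:
  assumes "finite S"
  shows "lubell S (\<lambda>B. lubell B (\<lambda>A. g A B)) = lubell S (\<lambda>D. lubell (S - D) (\<lambda>A. g A (A \<union> D)))"
proof -
  define n where "n = card S"
  have "lubell S (\<lambda>B. lubell B (\<lambda>A. g A B)) =
      (\<Sum>(B, A)\<in>Sigma (Pow S) Pow. g A B / real (card B choose card A) / real (n choose card B))"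
    unfolding lubell_def n_def sum_divide_distrib using assms
    by (intro sum.Sigma) (auto intro: finite_subset)
  also have "\<dots> = (\<Sum>(D, A)\<in>Sigma (Pow S) (\<lambda>D. Pow (S - D)).
      g A (A \<union> D) / real (card (S - D) choose card A) / real (n choose card D))"
  proof (rule sum.reindex_bij_witness[where j = "\<lambda>(B, A). (B - A, A)" and i = "\<lambda>(D, A). (A \<union> D, A)"])
    fix p assume p: "p \<in> Sigma (Pow S) Pow"
    obtain B A where BA: "p = (B, A)" "B \<subseteq> S" "A \<subseteq> B" using p by auto
    have fin: "finite B" "finite A"
      using BA assms by (auto intro: finite_subset[of A B] finite_subset[of B S])
    define a b where "a = card A" and "b = card B"
    have ab: "a \<le> b" "b \<le> n" unfolding a_def b_def n_def
      using BA fin assms by (auto intro: card_mono)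
    have cD: "card (B - A) = b - a" "card (S - (B - A)) = n - (b - a)"
      using BA fin assms by (simp_all add: card_Diff_subset a_def b_def n_def subset_trans[of "B - A" B S])
    have "(n choose b) * (b choose a) = (n choose (b - a)) * (n - (b - a) choose a)"
      using choose_mult[of "b - a" b n] binomial_symmetric[of a b] ab by simp
    hence "real (n choose b) * real (b choose a) = real (n choose (b - a)) * real (n - (b - a) choose a)"
      by (metis of_nat_mult)
    moreover have "A \<union> (B - A) = B" using BA by auto
    ultimately show "(case case p of (B, A) \<Rightarrow> (B - A, A) of
        (D, A) \<Rightarrow> g A (A \<union> D) / real (card (S - D) choose card A) / real (n choose card D)) =
      (case p of (B, A) \<Rightarrow> g A B / real (card B choose card A) / real (n choose card B))"
      using BA cD by (simp add: a_def b_def mult.commute)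
  qed auto
  also have "\<dots> = lubell S (\<lambda>D. lubell (S - D) (\<lambda>A. g A (A \<union> D)))"
    unfolding lubell_def n_def sum_divide_distrib using assms
    by (intro sum.Sigma[symmetric]) (auto intro: finite_subset)
  finally show ?thesis .
qed

section \<open>Families without Boolean algebras\<close>

text \<open>Boolean algebras inside \<open>F\<close>, with their generators removed one at a time: \<open>D\<close> is the last
  generator, and the algebra spanned by the others must lie in \<open>F\<close> both as it is and after adding \<open>D\<close>.\<close>

fun has_cube :: "nat \<Rightarrow> 'a set set \<Rightarrow> bool" where
  "has_cube 0 F \<longleftrightarrow> F \<noteq> {}"
| "has_cube (Suc d) F \<longleftrightarrow> (\<exists>D. D \<noteq> {} \<and> has_cube d {A \<in> F. A \<inter> D = {} \<and> A \<union> D \<in> F})"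

lemma has_cube_imp_generators:
  assumes "has_cube d F"
  shows "\<exists>X :: nat \<Rightarrow> 'a set. disjoint_family_on X {0..d} \<and> (\<forall>i\<in>{1..d}. X i \<noteq> {}) \<and>
           (\<forall>I\<subseteq>{1..d}. X 0 \<union> (\<Union>i\<in>I. X i) \<in> F)"
  using assms
proof (induction d arbitrary: F)
  case 0
  then obtain A where "A \<in> F" by auto
  then show ?case by (intro exI[of _ "\<lambda>_. A"]) (auto simp: disjoint_family_on_def)
next
  case (Suc d)
  then obtain D where D: "D \<noteq> {}" "has_cube d {A \<in> F. A \<inter> D = {} \<and> A \<union> D \<in> F}" by auto
  from Suc.IH[OF D(2)] obtain X :: "nat \<Rightarrow> 'a set" where
    X: "disjoint_family_on X {0..d}" "\<And>i. i \<in> {1..d} \<Longrightarrow> X i \<noteq> {}"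
      "\<And>I. I \<subseteq> {1..d} \<Longrightarrow> X 0 \<union> (\<Union>i\<in>I. X i) \<in> F"
      "\<And>I. I \<subseteq> {1..d} \<Longrightarrow> (X 0 \<union> (\<Union>i\<in>I. X i)) \<inter> D = {}"
      "\<And>I. I \<subseteq> {1..d} \<Longrightarrow> X 0 \<union> (\<Union>i\<in>I. X i) \<union> D \<in> F"
    by auto
  define Y where "Y = X(Suc d := D)"
  have Y: "Y i = X i" if "i \<le> d" for i using that by (simp add: Y_def)
  \<comment> \<open>Every \<open>X i\<close> lies in a member of the smaller algebra, and these members avoid \<open>D\<close>.\<close>
  have XD: "X i \<inter> D = {}" if "i \<le> d" for i
    using X(4)[of "{i} - {0}"] that by (cases "i = 0") auto
  have "disjoint_family_on Y {0..Suc d}"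
    unfolding disjoint_family_on_def
  proof (intro ballI impI)
    fix i j assume ij: "i \<in> {0..Suc d}" "j \<in> {0..Suc d}" "i \<noteq> j"
    have "X i \<inter> X j = {}" if "i \<le> d" "j \<le> d"
      using X(1) that ij(3) by (auto simp: disjoint_family_on_def)
    then show "Y i \<inter> Y j = {}"
      using XD[of i] XD[of j] ij by (auto simp: Y_def le_Suc_eq)
  qed
  moreover have "\<forall>i\<in>{1..Suc d}. Y i \<noteq> {}"
    using X(2) D(1) by (auto simp: Y_def)
  moreover have "Y 0 \<union> (\<Union>i\<in>I. Y i) \<in> F" if I: "I \<subseteq> {1..Suc d}" for I
  proof -
    define J where "J = I - {Suc d}"
    have J: "J \<subseteq> {1..d}" using I by (auto simp: J_def le_Suc_eq)
    have YJ: "(\<Union>i\<in>J. Y i) = (\<Union>i\<in>J. X i)" using J Y by (intro SUP_cong) auto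
    show ?thesis
    proof (cases "Suc d \<in> I")
      case True
      hence "Y 0 \<union> (\<Union>i\<in>I. Y i) = X 0 \<union> (\<Union>i\<in>J. X i) \<union> D"
        using YJ Y[of 0] by (subst insert_Diff[OF True, symmetric]) (auto simp: J_def Y_def)
      thus ?thesis using X(5)[OF J] by simp
    next
      case False
      hence "J = I" by (auto simp: J_def)
      thus ?thesis using YJ Y[of 0] X(3)[OF J] by simp
    qed
  qed
  ultimately show ?case by blast
qed

text \<open>Combining the two views of pairs on a chain. The difference \<open>D = {}\<close> contributes the diagonal
  pairs, that is \<open>h\<close> itself, while the other differences of size \<open>k\<close> contribute at most \<open>\<phi> (n - k)\<close>
  in total, as their average is weighted by \<open>1 / (n choose k)\<close>.\<close>

lemma lubell_cube_free_step:
  fixes F :: "'a set set"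
  assumes "finite S"
    and free: "\<not> has_cube (Suc d) F"
    and bound: "\<And>T (H :: 'a set set). finite T \<Longrightarrow> \<not> has_cube d H \<Longrightarrow> lubell_family T H \<le> \<phi> (card T)"
  shows "(lubell_family S F)\<^sup>2 - lubell_family S F \<le> 2 * (\<Sum>m<card S. \<phi> m)"
proof -
  define n where "n = card S"
  define f :: "'a set \<Rightarrow> real" where "f = (\<lambda>A. of_bool (A \<in> F))"
  define h where "h = lubell S f"
  define F' where "F' = (\<lambda>D. {A \<in> F. A \<inter> D = {} \<and> A \<union> D \<in> F})"
  have "h\<^sup>2 \<le> lubell S (\<lambda>B. f B * (2 * lubell B f - f B))"
    unfolding h_def using assms(1) by (rule lubell_squared_le)
  also have "\<dots> = lubell S (\<lambda>B. 2 * (f B * lubell B f) - f B)"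
    by (rule lubell_cong) (auto simp: f_def)
  also have "\<dots> = 2 * lubell S (\<lambda>B. f B * lubell B f) - h"
    by (simp only: lubell_diff lubell_cmult h_def)
  also have "lubell S (\<lambda>B. f B * lubell B f) = lubell S (\<lambda>B. lubell B (\<lambda>A. f B * f A))"
    by (simp only: lubell_cmult)
  also have "\<dots> = lubell S (\<lambda>D. lubell (S - D) (\<lambda>A. f (A \<union> D) * f A))"
    using assms(1) by (rule lubell_pairs_by_difference)
  also have "\<dots> = lubell S (\<lambda>D. lubell_family (S - D) (F' D))"
    by (intro lubell_cong) (auto simp: f_def F'_def)
  also have "\<dots> \<le> lubell S (\<lambda>D. if card D = 0 then h else \<phi> (n - card D))"
  proof (rule lubell_mono)
    fix D assume D: "D \<subseteq> S"
    hence fD: "finite D" using assms(1) finite_subset by blast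
    show "lubell_family (S - D) (F' D) \<le> (if card D = 0 then h else \<phi> (n - card D))"
    proof (cases "D = {}")
      case True
      thus ?thesis by (simp add: F'_def h_def f_def)
    next
      case False
      hence "\<not> has_cube d (F' D)" using free by (auto simp: F'_def)
      hence "lubell_family (S - D) (F' D) \<le> \<phi> (card (S - D))"
        using assms(1) by (intro bound) auto
      thus ?thesis using False fD D by (simp add: card_Diff_subset n_def)
    qed
  qed
  also have "\<dots> = (\<Sum>k\<le>n. if k = 0 then h else \<phi> (n - k))"
    unfolding n_def using assms(1) by (rule lubell_card)
  also have "\<dots> = h + (\<Sum>m<n. \<phi> m)"
    by (simp add: sum.atMost_shift sum.nat_diff_reindex[of \<phi> n, symmetric])
  finally show ?thesis by (simp add: h_def f_def n_def)
qed

text \<open>The next two lemmas compare \<open>\<Sum>m<n. (m + 1) powr (p - 1)\<close> with the integral of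
  \<open>x powr (p - 1)\<close> from \<open>1\<close> to \<open>n + 1\<close>.\<close>

lemma powr_diff_ge:
  fixes x p :: real
  assumes "x > 0" "p \<ge> 1"
  shows "p * x powr (p - 1) \<le> (x + 1) powr p - x powr p"
proof -
  have "\<exists>z. x < z \<and> z < x + 1 \<and> (x + 1) powr p - x powr p = (x + 1 - x) * (p * z powr (p - 1))"
    using assms by (intro MVT2) (auto intro!: derivative_eq_intros simp: powr_diff field_simps)
  then obtain z where "x < z" "(x + 1) powr p - x powr p = p * z powr (p - 1)" by auto
  thus ?thesis using assms by (auto intro!: mult_left_mono powr_mono2)
qed

lemma sum_powr_le:
  fixes p :: real
  assumes "p \<ge> 1"
  shows "p * (\<Sum>m<n. (real m + 1) powr (p - 1)) \<le> (real n + 1) powr p - 1"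
proof (induction n)
  case (Suc n)
  then show ?case using powr_diff_ge[of "real n + 1" p] assms by (simp add: algebra_simps)
qed simp

text \<open>A family without a one-dimensional algebra is an antichain, so this is the LYM inequality. Here
  it is the step from dimension \<open>0\<close>, where the family is empty and the bound is \<open>0\<close>. The constant \<open>1\<close>
  matters: starting from \<open>8/5\<close> instead, the bound for dimension \<open>2\<close> would come out too large.\<close>

lemma lubell_antichain_le_1:
  fixes F :: "'a set set"
  assumes "finite S" "\<not> has_cube (Suc 0) F"
  shows "lubell_family S F \<le> 1"
proof -
  define h where "h = lubell_family S F"
  have "h\<^sup>2 - h \<le> 2 * (\<Sum>m<card S. 0)"
    unfolding h_def
  proof (rule lubell_cube_free_step[OF assms])
    fix T :: "'a set" and H :: "'a set set"
    assume "\<not> has_cube 0 H"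
    hence "H = {}" by simp
    show "lubell_family T H \<le> 0" unfolding \<open>H = {}\<close> by (simp add: lubell_def)
  qed
  hence "h * h \<le> h * 1" by (simp add: power2_eq_square)
  hence "h \<le> 1" if "h > 0" using that by (rule mult_left_le_imp_le)
  thus ?thesis unfolding h_def[symmetric] by (cases "h > 0") auto
qed

text \<open>At \<open>h = 8/5 * y\<close> the difference \<open>h\<^sup>2 - h - 32/15 * (y\<^sup>2 - 1)\<close> is the quadratic
  \<open>32/75 * y\<^sup>2 - 8/5 * y + 32/15\<close>, whose discriminant is negative. So the linear term \<open>h\<close>
  is absorbed for every \<open>y\<close>, not only for large ones. The \<open>- 1\<close> in the hypothesis, the lower end of the
  integral above, is what makes this work.\<close>

lemma less_of_quadratic_bound:
  fixes h y :: real
  assumes "h\<^sup>2 - h \<le> 32/15 * (y\<^sup>2 - 1)" "y \<ge> 1"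
  shows "h < 8/5 * y"
proof (rule ccontr)
  assume "\<not> h < 8/5 * y"
  hence "(h - 8/5 * y) * (h + 8/5 * y - 1) \<ge> 0"
    using assms(2) by (intro mult_nonneg_nonneg) auto
  \<comment> \<open>The vertex of the quadratic is \<open>y = 15/8\<close>.\<close>
  moreover have "(8 * y - 15)\<^sup>2 \<ge> 0" by simp
  ultimately show False
    using assms(1) by (simp add: power2_eq_square algebra_simps)
qed

text \<open>From dimension \<open>d\<close> to \<open>d + 1\<close> with \<open>\<gamma> = 1 - 1 / 2 ^ d\<close> and \<open>y = (n + 1) powr \<gamma>\<close>, the sum
  of the bounds is at most \<open>8/5 * (y\<^sup>2 - 1) / (2 * \<gamma>)\<close>. For \<open>d \<ge> 2\<close> we have \<open>\<gamma> \<ge> 3/4\<close>, which gives the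
  factor \<open>32/15\<close> that \<open>less_of_quadratic_bound\<close> can bear. Between the dimensions \<open>1\<close> and \<open>2\<close>, where
  \<open>\<gamma> = 1/2\<close>, the constant \<open>1\<close> for antichains gives the factor \<open>2\<close> instead.\<close>

theorem lubell_cube_free_less:
  assumes "finite S" "\<not> has_cube d F" "d \<ge> 2"
  shows "lubell_family S F < 8/5 * (real (card S) + 1) powr (1 - 2 / 2 ^ d)"
  using assms(3,1,2)
proof (induction d arbitrary: S F rule: dec_induct)
  case base
  define h where "h = lubell_family S F"
  define y where "y = (real (card S) + 1) powr (1 / 2)"
  have y: "y \<ge> 1" "y\<^sup>2 = real (card S) + 1"
    unfolding y_def by (simp_all add: powr_half_sqrt)
  have "h\<^sup>2 - h \<le> 2 * (\<Sum>m<card S. 1)"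
    unfolding h_def
    by (rule lubell_cube_free_step[OF base(1), of 1])
      (use base(2) lubell_antichain_le_1 in \<open>auto simp: numeral_2_eq_2\<close>)
  hence h: "h\<^sup>2 - h \<le> 32/15 * (y\<^sup>2 - 1)" by (simp add: y)
  have "h < 8/5 * y"
    using h y by (intro less_of_quadratic_bound) auto
  then show ?case by (simp add: h_def y_def)
next
  case (step d)
  define h where "h = lubell_family S F"
  define \<gamma> :: real where "\<gamma> = 1 - 1 / 2 ^ d"
  define y where "y = (real (card S) + 1) powr \<gamma>"
  have \<gamma>: "\<gamma> \<ge> 3/4"
  proof -
    have "(2::real) ^ 2 \<le> 2 ^ d" using step.hyps by (intro power_increasing) auto
    thus ?thesis by (simp add: \<gamma>_def field_simps)
  qed
  have y: "y \<ge> 1" "y\<^sup>2 = (real (card S) + 1) powr (2 * \<gamma>)" 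
    unfolding y_def using \<gamma> by (auto simp: powr_powr[symmetric] ge_one_powr_ge_zero mult.commute powr_numeral)
  define M where "M = (\<Sum>m<card S. (real m + 1) powr (2 * \<gamma> - 1))"
  have "h\<^sup>2 - h \<le> 2 * (\<Sum>m<card S. 8/5 * (real m + 1) powr (1 - 2 / 2 ^ d))"
    unfolding h_def
    by (rule lubell_cube_free_step[OF step.prems]) (rule less_imp_le[OF step.IH])
  also have "\<dots> = 16/5 * (\<Sum>m<card S. (real m + 1) powr (2 * \<gamma> - 1))"
    by (simp add: sum_distrib_left \<gamma>_def)
  finally have h: "h\<^sup>2 - h \<le> 16/5 * M" by (simp add: M_def)
  have "3/2 * M \<le> 2 * \<gamma> * M"
    using \<gamma> by (intro mult_right_mono) (auto simp: M_def intro!: sum_nonneg)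
  also have "\<dots> \<le> y\<^sup>2 - 1"
    unfolding y(2) M_def using \<gamma> by (intro sum_powr_le) auto
  finally have h': "h\<^sup>2 - h \<le> 32/15 * (y\<^sup>2 - 1)" using h by simp
  have "h < 8/5 * y"
    using h' y by (intro less_of_quadratic_bound) auto
  then show ?case by (simp add: h_def y_def \<gamma>_def)
qed

section \<open>Colourings\<close>

text \<open>The Lubell values of the colour classes add up to \<open>n + 1\<close>. If no class contained an algebra,
  each of the \<open>r\<close> values would be below \<open>8/5 * (n + 1) powr (1 - 2 / 2 ^ d)\<close>, too little in total.\<close>

lemma forces_copy_of_le:
  assumes "d \<ge> 2" "real r \<le> 5/8 * (real n + 1) powr (2 / 2 ^ d)"
  shows "forces_copy d n r"
proof -
  have "\<exists>\<B>. boolean_algebra_copy d n \<B> \<and> monochromatic c \<B>" if c: "colouring r n c" for c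
  proof -
    define F where "F = (\<lambda>k. {A \<in> Pow {1..n}. c A = k})"
    define h where "h = (\<lambda>k. lubell_family {1..n} (F k))"
    define N :: real where "N = real n + 1"
    have "\<exists>k. has_cube d (F k)"
    proof (rule ccontr)
      assume "\<not> ?thesis"
      hence h: "h k < 8/5 * N powr (1 - 2 / 2 ^ d)" for k
        using lubell_cube_free_less[of "{1..n}" d "F k"] assms(1) by (simp add: h_def N_def)
      have "c {} \<in> {1..r}" using c by (auto simp: colouring_def Pi_def)
      hence r: "r > 0" by auto
      have "N = lubell {1..n} (\<lambda>A. 1)"
        using lubell_card[of "{1..n}" "\<lambda>_. 1"] by (simp add: N_def)
      also have "\<dots> = lubell {1..n} (\<lambda>A. \<Sum>k\<in>{1..r}. of_bool (A \<in> F k))"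
      proof (rule lubell_cong)
        fix A assume A: "A \<subseteq> {1..n}"
        hence "c A \<in> {1..r}" using c by (auto simp: colouring_def Pi_def)
        thus "1 = (\<Sum>k\<in>{1..r}. of_bool (A \<in> F k) :: real)" using A by (simp add: F_def of_bool_def)
      qed
      also have "\<dots> = (\<Sum>k\<in>{1..r}. h k)" by (simp only: lubell_sum h_def)
      also have "\<dots> < (\<Sum>k\<in>{1..r}. 8/5 * N powr (1 - 2 / 2 ^ d))"
        using r h by (intro sum_strict_mono) auto
      also have "\<dots> = real r * (8/5 * N powr (1 - 2 / 2 ^ d))" by simp
      also have "\<dots> \<le> 5/8 * N powr (2 / 2 ^ d) * (8/5 * N powr (1 - 2 / 2 ^ d))"
        using assms(2) by (intro mult_right_mono) (auto simp: N_def)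
      also have "\<dots> = N"
        by (simp add: powr_add[symmetric] N_def)
      finally show False by simp
    qed
    then obtain k where "has_cube d (F k)" by blast
    from has_cube_imp_generators[OF this] obtain X :: "nat \<Rightarrow> nat set" where
      X: "disjoint_family_on X {0..d}" "\<forall>i\<in>{1..d}. X i \<noteq> {}"
        "\<And>I. I \<subseteq> {1..d} \<Longrightarrow> X 0 \<union> (\<Union>i\<in>I. X i) \<in> F k" by blast
    define \<B> where "\<B> = {X 0 \<union> (\<Union>i\<in>I. X i) | I. I \<subseteq> {1..d}}"
    have "X i \<subseteq> {1..n}" if "i \<in> {0..d}" for i
    proof -
      have "{i} - {0} \<subseteq> {1..d}" using that by auto
      hence "X 0 \<union> (\<Union>j\<in>{i} - {0}. X j) \<subseteq> {1..n}" using X(3) unfolding F_def by blast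
      thus ?thesis by (cases "i = 0") auto
    qed
    with X(1,2) have "boolean_algebra_copy d n \<B>"
      unfolding boolean_algebra_copy_def by (intro exI[of _ X]) (simp add: \<B>_def)
    moreover have "\<B> \<subseteq> F k"
      unfolding \<B>_def using X(3) by blast
    hence "monochromatic c \<B>"
      unfolding monochromatic_def F_def by blast
    ultimately show ?thesis by blast
  qed
  thus ?thesis by (simp add: forces_copy_def)
qed

theorem theorem3:
  fixes d :: nat
  assumes "d > 2"
  shows "(\<forall>\<^sub>F n in sequentially. real (boolean_ramsey d n) \<ge> 1/2 * (real n + 1) powr (2 / 2 ^ d)) \<and>
         (\<forall>n>0. int (boolean_ramsey d n) \<ge> \<lfloor>1/2 * (real n + 1) powr (2 / 2 ^ d)\<rfloor>)"
proof (intro conjI allI impI)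
  define t where "t = (\<lambda>n. (real n + 1) powr (2 / 2 ^ d))"
  have greatest: "r \<le> boolean_ramsey d n" if "real r \<le> 5/8 * t n" for r n
    using that assms by (intro boolean_ramsey_greatest forces_copy_of_le) (auto simp: t_def)
  \<comment> \<open>Rounding \<open>1/2 * t n\<close> up adds less than \<open>1\<close>, which is at most \<open>1/8 * t n\<close> once \<open>t n \<ge> 8\<close>.\<close>
  define a :: real where "a = 2 / 2 ^ d"
  have a: "a > 0" by (simp add: a_def)
  have "\<forall>\<^sub>F n in sequentially. nat \<lceil>8 powr (1 / a) :: real\<rceil> \<le> n"
    by (rule eventually_ge_at_top)
  hence "\<forall>\<^sub>F n in sequentially. t n \<ge> 8"
  proof eventually_elim
    case (elim n)
    have "(8::real) = (8 powr (1 / a)) powr a" using a by (simp add: powr_powr)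
    also have "\<dots> \<le> (real n + 1) powr a"
      using elim a by (intro powr_mono2) (auto simp: nat_ceiling_le_eq)
    finally show ?case by (simp add: t_def a_def)
  qed
  thus "\<forall>\<^sub>F n in sequentially. real (boolean_ramsey d n) \<ge> 1/2 * (real n + 1) powr (2 / 2 ^ d)"
  proof eventually_elim
    case (elim n)
    have "real (nat \<lceil>1/2 * t n\<rceil>) \<le> 5/8 * t n" using elim by linarith
    from greatest[OF this] show ?case unfolding t_def by linarith
  qed
  fix n :: nat
  have "t n \<ge> 0" by (simp add: t_def)
  hence "real (nat \<lfloor>1/2 * t n\<rfloor>) \<le> 5/8 * t n" by linarith
  from greatest[OF this] show "int (boolean_ramsey d n) \<ge> \<lfloor>1/2 * (real n + 1) powr (2 / 2 ^ d)\<rfloor>"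
    unfolding t_def by linarith
qed

end
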